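(* Let $p$ be a prime with $p\equiv 3\pmod 4$ and let $f$ be an admissible function on $\mathbb{F}_p$. If the $4$-graph $\mathcal{H}_f$ contains no copy of $\mathcal{H}(4)$ and has exactly $\frac{n}{16}\binom{n}{3}$ edges, where $n=p+1$, then $\mathcal{H}_f=\mathcal{H}_p$.
   Context: For an abelian group $A$ of odd order, $f:A\to\{0,\pm1\}$ is admissible if $f(a)=0$ iff $a=0$ and $f(-a)=-f(a)$ for all $a$. $T_f$ is the tournament on $A$ with $(x,y)$ an edge iff $f(y-x)=1$; $T_f^+$ adds a new vertex $\infty$ with $(x,\infty)$ an edge for every $x\in A$. For a tournament $T$, $e_T(x,y)=1$ if $(x,y)$ is an edge, $-1$ otherwise, and $g_T(x,y,z)=e_T(x,y)e_T(y,z)e_T(z,x)$ (an oriented two-graph). $\chi:\mathbb{F}_p\to\{0,\pm1\}$ is the quadratic character ($\chi(0)=0$, $\chi(x)=1$ for nonzero squares, $-1$ otherwise), which is admissible. $g_3:=g_{T_\chi^+}$ for $p=3$, i.e. the oriented two-graph of the cyclic triangle $0\to1\to2\to0$ augmented by a vertex $\infty$ with all edges directed into $\infty$. $\mathcal{H}_f$ is the $4$-graph on $\mathbb{F}_p\cup\{\infty\}$ whose edges are the $4$-sets $X$ with $g_{T_f^+}|_X\cong g_3$ (restriction to triples from $X$; isomorphism via a bijection preserving the function), and $\mathcal{H}_p:=\mathcal{H}_\chi$. $\mathcal{H}(4)$ is the $4$-graph on $5$ vertices with $3$ edges. *)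

theory Defs
  imports
    Complex_Main
    "HOL-Number_Theory.Cong"
    "HOL-Computational_Algebra.Primes"
    "HOL-Library.Numeral_Type"
begin

definition admissible :: "('a::ab_group_add \<Rightarrow> int) \<Rightarrow> bool" where
  "admissible f \<longleftrightarrow>
     range f \<subseteq> {-1, 0, 1} \<and> (\<forall>a. f a = 0 \<longleftrightarrow> a = 0) \<and> (\<forall>a. f (- a) = - f a)"

text \<open>A tournament is represented by its set of edges; its vertex set is the whole type.\<close>

definition tournament :: "('a::ab_group_add \<Rightarrow> int) \<Rightarrow> 'a rel" where
  "tournament f = {(x, y). f (y - x) = 1}"

text \<open>The constructor \<^const>\<open>None\<close> plays the role of the new vertex \<open>\<infinity>\<close>.\<close>

definition augment :: "'a rel \<Rightarrow> 'a option rel" where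
  "augment T = {(Some x, Some y) | x y. (x, y) \<in> T} \<union> {(Some x, None) | x. True}"

definition edge_sign :: "'v rel \<Rightarrow> 'v \<Rightarrow> 'v \<Rightarrow> int" where
  "edge_sign T x y = (if (x, y) \<in> T then 1 else - 1)"

definition two_graph :: "'v rel \<Rightarrow> 'v \<Rightarrow> 'v \<Rightarrow> 'v \<Rightarrow> int" where
  "two_graph T x y z = edge_sign T x y * edge_sign T y z * edge_sign T z x"

text \<open>
  Isomorphism of the restriction of \<open>g\<close> to \<open>X\<close> with the restriction of \<open>h\<close> to \<open>Y\<close>. Oriented
  two-graphs are functions of triples of distinct vertices, so only those triples matter.
\<close>

definition two_graph_iso ::
  "'v set \<Rightarrow> ('v \<Rightarrow> 'v \<Rightarrow> 'v \<Rightarrow> int) \<Rightarrow> 'w set \<Rightarrow> ('w \<Rightarrow> 'w \<Rightarrow> 'w \<Rightarrow> int) \<Rightarrow> bool" where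
  "two_graph_iso X g Y h \<longleftrightarrow>
     (\<exists>\<phi>. bij_betw \<phi> X Y \<and>
       (\<forall>x\<in>X. \<forall>y\<in>X. \<forall>z\<in>X. distinct [x, y, z] \<longrightarrow> h (\<phi> x) (\<phi> y) (\<phi> z) = g x y z))"

text \<open>
  The class is a ring, rather than a field, only because the numeral type \<open>3\<close> of integers
  modulo 3 is not declared as a field in the library.
\<close>

definition quad_char :: "'a::comm_ring_1 \<Rightarrow> int" where
  "quad_char x = (if x = 0 then 0 else if \<exists>y. x = y\<^sup>2 then 1 else - 1)"

lemma tournament_quad_char_3: "(x, y) \<in> tournament (quad_char :: 3 \<Rightarrow> int) \<longleftrightarrow> y = x + 1"
proof -
  have cases3: "z = 0 \<or> z = 1 \<or> z = 2" for z :: 3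
  proof (induct z)
    case (of_int z)
    then have "z = 0 \<or> z = 1 \<or> z = 2" by fastforce
    then show ?case by auto
  qed
  have sq: "z\<^sup>2 = 0 \<or> z\<^sup>2 = 1" for z :: 3
    using cases3[of z] by (auto simp: power2_eq_square)
  have "quad_char z = 1 \<longleftrightarrow> z = 1" for z :: 3
  proof -
    have "quad_char (1::3) = 1"
      unfolding quad_char_def by (auto intro: exI[of _ 1])
    moreover have "quad_char (2::3) \<noteq> 1"
    proof -
      have "2 \<noteq> y\<^sup>2" for y :: 3
        using sq[of y] by (elim disjE) simp_all
      then show ?thesis by (simp add: quad_char_def)
    qed
    moreover have "quad_char (0::3) = 0"
      by (simp add: quad_char_def)
    ultimately show ?thesis
      using cases3[of z] by (elim disjE) simp_all
  qed
  then show ?thesis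
    by (auto simp: tournament_def algebra_simps)
qed

definition g3 :: "3 option \<Rightarrow> 3 option \<Rightarrow> 3 option \<Rightarrow> int" where
  "g3 = two_graph (augment (tournament quad_char))"

text \<open>A 4-graph on all of a type is represented by its set of edges.\<close>

definition four_graph :: "('a::ab_group_add \<Rightarrow> int) \<Rightarrow> 'a option set set" where
  "four_graph f =
     {X. card X = 4 \<and> two_graph_iso X (two_graph (augment (tournament f))) UNIV g3}"

text \<open>
  Up to isomorphism there is one 4-graph with 5 vertices and 3 edges, since its edges are the
  complements of three vertices.
\<close>

definition H4_vertices :: "nat set" where
  "H4_vertices = {..<5}"

definition H4_edges :: "nat set set" where
  "H4_edges = {H4_vertices - {0}, H4_vertices - {1}, H4_vertices - {2}}"

text \<open>A copy is a subgraph that need not be induced.\<close>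

definition contains_H4 :: "'v set set \<Rightarrow> bool" where
  "contains_H4 H \<longleftrightarrow> (\<exists>\<phi>. inj_on \<phi> H4_vertices \<and> (\<forall>e\<in>H4_edges. \<phi> ` e \<in> H))"

end

theory Submission
  imports
    Defs
    "HOL-Library.Poly_Mapping"
    "HOL-Number_Theory.Residues"
    "HOL-Combinatorics.Multiset_Permutations"
begin

text \<open>
  Let \<open>S\<close> be the skew sign matrix of \<open>T\<^sub>f\<^sup>+\<close>. A 4-set is an edge of \<open>\<H>\<^sub>f\<close> iff its three
  4-cycles all have sign product \<open>-1\<close>; otherwise exactly one of them does. Hence the number of
  edges is an affine function of the trace of \<open>S\<^sup>4\<close>, that is, of the sum of the squared entries of
  \<open>S S\<^sup>T\<close>, and the assumed value forces all off-diagonal entries of \<open>S S\<^sup>T\<close> to vanish. In the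
  integral group ring of \<open>\<F>\<^sub>p\<close> this says \<open>F\<^sup>2 = J - p\<close> for \<open>F = \<Sum>\<^sub>a f(a) [a]\<close> and
  \<open>J = \<Sum>\<^sub>a [a]\<close>; as \<open>F J = 0\<close>, odd powers of \<open>F\<close> are integer multiples of \<open>F\<close>. For an odd prime
  \<open>q\<close>, comparing this with \<open>F\<^sup>q \<equiv> \<Sum>\<^sub>a f(a) [q a]\<close> modulo \<open>q\<close> gives \<open>f(q a) = f(1) f(q) f(a)\<close>,
  because the two sides differ by less than \<open>q\<close>. So \<open>f(1) f\<close> is multiplicative and
  \<open>f = \<plusminus>\<chi>\<close>; changing the sign of \<open>f\<close> does not change any 4-cycle product.
\<close>

section \<open>Admissible functions and sign matrices\<close>

lemma admissible_odd: "admissible f \<Longrightarrow> f (- a) = - f a"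
  by (simp add: admissible_def)

lemma admissible_zero_iff: "admissible f \<Longrightarrow> f a = 0 \<longleftrightarrow> a = 0"
  by (simp add: admissible_def)

lemma admissible_cases:
  assumes "admissible f"
  obtains "f a = 0" "a = 0" | "f a = 1" "a \<noteq> 0" | "f a = -1" "a \<noteq> 0"
proof -
  have "f a \<in> {-1, 0, 1}" using assms by (auto simp: admissible_def)
  then show ?thesis using that assms by (auto simp: admissible_zero_iff)
qed

lemma admissible_square:
  assumes "admissible f"
  shows "f a * f a = (if a = 0 then 0 else 1)"
  by (rule admissible_cases[OF assms, of a]) auto

lemma admissible_sum:
  fixes f :: "'a::{ab_group_add, finite} \<Rightarrow> int"
  assumes "admissible f"
  shows "(\<Sum>a\<in>UNIV. f a) = 0"
proof -
  have "(\<Sum>a\<in>UNIV. f a) = (\<Sum>a\<in>UNIV. f (- a))"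
    by (rule sum.reindex_bij_witness[of _ uminus uminus]) auto
  also have "\<dots> = - (\<Sum>a\<in>UNIV. f a)"
    by (simp add: admissible_odd[OF assms] sum_negf)
  finally show ?thesis by simp
qed

text \<open>Unlike \<open>edge_sign\<close>, the entries vanish on the diagonal, so in sums over all
  vertices the closed walks that stay put for a step drop out.\<close>

fun seidel :: "('a::ab_group_add \<Rightarrow> int) \<Rightarrow> 'a option \<Rightarrow> 'a option \<Rightarrow> int" where
  "seidel f (Some x) (Some y) = f (y - x)"
| "seidel f (Some x) None = 1"
| "seidel f None (Some x) = -1"
| "seidel f None None = 0"

lemma seidel_diag: "admissible f \<Longrightarrow> seidel f x x = 0"
  by (cases x) (simp_all add: admissible_zero_iff)

lemma seidel_skew: "admissible f \<Longrightarrow> seidel f y x = - seidel f x y"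
  by (cases x; cases y) (simp_all flip: admissible_odd)

lemma seidel_sign:
  assumes "admissible f" "x \<noteq> y"
  shows "seidel f x y = 1 \<or> seidel f x y = -1"
  by (rule admissible_cases[OF assms(1), of "the y - the x"]; use assms(2) in \<open>cases x; cases y\<close>)
    auto

lemma edge_sign_eq_seidel:
  assumes "admissible f" "x \<noteq> y"
  shows "edge_sign (augment (tournament f)) x y = seidel f x y"
  using assms seidel_sign[OF assms]
  by (cases x; cases y) (auto simp: edge_sign_def augment_def tournament_def)

text \<open>For a skew sign matrix and distinct vertices this is -g(w,x,y) g(y,z,w), where g is the
  oriented two-graph: the two triples share the pair w, y with opposite directions. Hence it depends
  on g only.\<close>

definition four_cycle :: "('v \<Rightarrow> 'v \<Rightarrow> int) \<Rightarrow> 'v \<Rightarrow> 'v \<Rightarrow> 'v \<Rightarrow> 'v \<Rightarrow> int" where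
  "four_cycle S w x y z = S w x * S x y * S y z * S z w"

lemma two_graph_eq_seidel:
  assumes "admissible f" "distinct [x, y, z]"
  shows "two_graph (augment (tournament f)) x y z = seidel f x y * seidel f y z * seidel f z x"
  using assms by (auto simp: two_graph_def edge_sign_eq_seidel)

section \<open>Recognising copies of \<open>g3\<close> by 4-cycle products\<close>

lemma edge_sign_3:
  "edge_sign (augment (tournament (quad_char :: 3 \<Rightarrow> int))) (Some x) (Some y) =
     (if y = x + 1 then 1 else - 1)"
  "edge_sign (augment (tournament (quad_char :: 3 \<Rightarrow> int))) (Some x) None = 1"
  "edge_sign (augment (tournament (quad_char :: 3 \<Rightarrow> int))) None v = - 1"
  by (auto simp: edge_sign_def augment_def tournament_quad_char_3)

lemma three_cases: "z = 0 \<or> z = 1 \<or> z = (2 :: 3)"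
proof (induct z)
  case (of_int z)
  then have "z = 0 \<or> z = 1 \<or> z = 2" by fastforce
  then show ?case by auto
qed

lemma UNIV_option_3: "(UNIV :: 3 option set) = {None, Some 0, Some 1, Some 2}"
  using three_cases by (auto simp: UNIV_option_conv)

text \<open>A finite check. It says that every 4-cycle product of \<open>g3\<close> is -1, the
  property that singles out edges below.\<close>

lemma g3_opposite:
  assumes "distinct [w, x, y, z]"
  shows "g3 w x y = g3 y z w"
proof -
  have "\<forall>w\<in>UNIV. \<forall>x\<in>UNIV. \<forall>y\<in>UNIV. \<forall>z\<in>UNIV. distinct [w, x, y, z] \<longrightarrow> g3 w x y = g3 y z w"
    unfolding UNIV_option_3 by (simp add: g3_def two_graph_def edge_sign_3)
  then show ?thesis using assms by blast
qed

lemma mem_four_graph_iff: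
  assumes f: "admissible f" and dist: "distinct [w, x, y, z]"
  shows "{w, x, y, z} \<in> four_graph f \<longleftrightarrow>
    four_cycle (seidel f) w x y z = -1 \<and> four_cycle (seidel f) w x z y = -1 \<and>
    four_cycle (seidel f) w y x z = -1"
    (is "_ \<longleftrightarrow> ?C")
proof
  let ?g = "two_graph (augment (tournament f))"
  assume "{w, x, y, z} \<in> four_graph f"
  then obtain \<phi> where \<phi>: "bij_betw \<phi> {w, x, y, z} UNIV"
    and "\<forall>a\<in>{w, x, y, z}. \<forall>b\<in>{w, x, y, z}. \<forall>c\<in>{w, x, y, z}.
      distinct [a, b, c] \<longrightarrow> g3 (\<phi> a) (\<phi> b) (\<phi> c) = ?g a b c"
    unfolding four_graph_def two_graph_iso_def by blast
  then have iso: "g3 (\<phi> a) (\<phi> b) (\<phi> c) = ?g a b c"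
    if "{a, b, c} \<subseteq> {w, x, y, z}" "distinct [a, b, c]" for a b c
    using that by blast
  have cyc: "four_cycle (seidel f) a b c d = -1"
    if abcd: "{a, b, c, d} \<subseteq> {w, x, y, z}" "distinct [a, b, c, d]" for a b c d
  proof -
    have "distinct [\<phi> a, \<phi> b, \<phi> c, \<phi> d]"
      using abcd inj_on_contraD[OF bij_betw_imp_inj_on[OF \<phi>]] by (simp del: insert_iff) blast
    then have "g3 (\<phi> a) (\<phi> b) (\<phi> c) = g3 (\<phi> c) (\<phi> d) (\<phi> a)" by (rule g3_opposite)
    moreover have "g3 (\<phi> a) (\<phi> b) (\<phi> c) = ?g a b c" "g3 (\<phi> c) (\<phi> d) (\<phi> a) = ?g c d a"
      using iso[of a b c] iso[of c d a] abcd by (simp_all add: eq_commute[of _ a])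
    ultimately have "?g a b c = ?g c d a" by simp
    \<comment> \<open>The two triples run through the pair a, c in opposite directions; cancelling
      it by skewness leaves the sign -1.\<close>
    then have *: "seidel f a b * seidel f b c * seidel f c a = seidel f c d * seidel f d a * seidel f a c"
      using abcd(2) by (simp add: two_graph_eq_seidel[OF f] eq_commute[of _ a])
    show ?thesis
      using * abcd(2) seidel_sign[OF f, of a b] seidel_sign[OF f, of b c] seidel_sign[OF f, of c a]
        seidel_sign[OF f, of c d] seidel_sign[OF f, of d a] seidel_skew[OF f, of a c]
      unfolding four_cycle_def by auto
  qed
  show ?C using dist by (intro conjI cyc) auto
next
  assume C: ?C
  have main: "two_graph_iso {w, x, y, z} (two_graph (augment (tournament f))) UNIV g3"
    if dist: "distinct [w, x, y, z]"
    and C: "four_cycle (seidel f) w x y z = -1" "four_cycle (seidel f) w x z y = -1"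
       "four_cycle (seidel f) w y x z = -1"
    and t: "seidel f w x * seidel f x y * seidel f y w = -1" for w x y z
  proof -
    \<comment> \<open>Send w to infinity and x, y, z to the triangle 0, 1, 2. Hypothesis
      \<open>t\<close> fixes the orientation, since
      \<open>g3 None (Some 0) (Some 1) = -1\<close>.\<close>
    define \<phi> where "\<phi> v = (if v = w then None else if v = x then Some 0
        else if v = y then Some 1 else Some (2::3))" for v
    have \<phi>: "\<phi> w = None" "\<phi> x = Some 0" "\<phi> y = Some 1" "\<phi> z = Some 2"
      using dist by (auto simp: \<phi>_def)
    have "bij_betw \<phi> {w, x, y, z} UNIV"
      using dist unfolding bij_betw_def UNIV_option_3 by (auto simp: inj_on_def \<phi>)
    have skew: "seidel f x w = - seidel f w x" "seidel f y w = - seidel f w y"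
      "seidel f z w = - seidel f w z" "seidel f y x = - seidel f x y"
      "seidel f z x = - seidel f x z" "seidel f z y = - seidel f y z"
      using seidel_skew[OF f] by blast+
    have sign: "seidel f w x = 1 \<or> seidel f w x = -1" "seidel f w y = 1 \<or> seidel f w y = -1"
      "seidel f w z = 1 \<or> seidel f w z = -1" "seidel f x y = 1 \<or> seidel f x y = -1"
      "seidel f x z = 1 \<or> seidel f x z = -1" "seidel f y z = 1 \<or> seidel f y z = -1"
      using seidel_sign[OF f] dist by auto
    \<comment> \<open>All signs are now determined by those at w. After switching vertices so that
      every edge at w points into w, the triple x, y, z becomes the cyclic triangle.\<close>
    have xy: "seidel f x y = seidel f w x * seidel f w y"
      using sign(1,2,4) t unfolding skew by (elim disjE) simp_all
    have yz: "seidel f y z = seidel f w y * seidel f w z"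
      using sign(1-3,6) C(1) unfolding four_cycle_def skew xy by (elim disjE) simp_all
    have xz: "seidel f x z = - (seidel f w x * seidel f w z)"
      using sign(1-3,5) C(2) unfolding four_cycle_def skew yz by (elim disjE) simp_all
    have "\<forall>a\<in>{w, x, y, z}. \<forall>b\<in>{w, x, y, z}. \<forall>c\<in>{w, x, y, z}. distinct [a, b, c] \<longrightarrow>
      g3 (\<phi> a) (\<phi> b) (\<phi> c) = seidel f a b * seidel f b c * seidel f c a"
      using sign(1-3) dist
      by (elim disjE) (simp_all add: \<phi> skew xy yz xz g3_def two_graph_def edge_sign_3)
    then show ?thesis
      using \<open>bij_betw \<phi> {w, x, y, z} UNIV\<close> two_graph_eq_seidel[OF f]
      unfolding two_graph_iso_def by (intro exI[of _ \<phi>]) simp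
  qed
  have card: "card {w, x, y, z} = 4" using dist by simp
  \<comment> \<open>Reversing a triangle negates the product of its three signs, so one of the two
    orientations gives -1.\<close>
  have "seidel f w x * seidel f x y * seidel f y w = -1 \<or>
      seidel f w y * seidel f y x * seidel f x w = -1"
    using dist seidel_sign[OF f, of w x] seidel_sign[OF f, of x y] seidel_sign[OF f, of y w]
      seidel_skew[OF f, of x y] seidel_skew[OF f, of w x] seidel_skew[OF f, of y w] by auto
  then show "{w, x, y, z} \<in> four_graph f"
  proof
    assume "seidel f w x * seidel f x y * seidel f y w = -1"
    then show ?thesis using main[OF dist] C card by (simp add: four_graph_def)
  next
    assume t: "seidel f w y * seidel f y x * seidel f x w = -1"
    \<comment> \<open>Reversing a closed walk of length four changes four signs and thus preserves
      its product.\<close>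
    have "four_cycle (seidel f) w y z x = four_cycle (seidel f) w x z y"
      unfolding four_cycle_def seidel_skew[OF f, of w y] seidel_skew[OF f, of z y]
        seidel_skew[OF f, of x z] seidel_skew[OF f, of x w] by simp
    moreover have "distinct [w, y, x, z]" using dist by auto
    ultimately have "two_graph_iso {w, y, x, z} (two_graph (augment (tournament f))) UNIV g3"
      by (intro main) (use t C in simp_all)
    then show ?thesis using card by (simp add: four_graph_def insert_commute)
  qed
qed

text \<open>Only entries between finite vertices change sign. A closed walk of length four contains
  an even number of such steps, unless it stays at infinity for a step, and then its product is
  zero.\<close>

lemma four_graph_uminus:
  assumes f: "admissible f"
  shows "four_graph (\<lambda>x. - f x) = four_graph f"
proof -
  have f': "admissible (\<lambda>x. - f x)" using f by (force simp: admissible_def)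
  have cycle: "four_cycle (seidel (\<lambda>x. - f x)) w x y z = four_cycle (seidel f) w x y z" for w x y z
    unfolding four_cycle_def by (cases w; cases x; cases y; cases z) simp_all
  have "X \<in> four_graph (\<lambda>x. - f x) \<longleftrightarrow> X \<in> four_graph f" for X
  proof (cases "card X = 4")
    case True
    then obtain w x y z where "X = {w, x, y, z}" "distinct [w, x, y, z]"
      by (auto simp: card_Suc_eq numeral_eq_Suc)
    then show ?thesis by (simp add: mem_four_graph_iff f f' cycle)
  qed (simp add: four_graph_def)
  then show ?thesis by blast
qed

section \<open>Counting edges by closed walks of length four\<close>

definition distinct_quadruples :: "('v \<times> 'v \<times> 'v \<times> 'v) set" where
  "distinct_quadruples = {(w, x, y, z). distinct [w, x, y, z]}"

text \<open>Quadruples become lists so that the counts of distinct lists and of permutations of a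
  set apply.\<close>

lemma bij_betw_distinct_quadruples:
  "bij_betw (\<lambda>(w, x, y, z). [w, x, y, z]) {(w, x, y, z). distinct [w, x, y, z] \<and> P {w, x, y, z}}
     {xs. length xs = 4 \<and> distinct xs \<and> P (set xs)}"
  by (rule bij_betw_byWitness[where f' = "\<lambda>xs. (xs ! 0, xs ! 1, xs ! 2, xs ! 3)"])
     (auto simp: length_Suc_conv numeral_eq_Suc)

lemma card_distinct_quadruples:
  "int (card (distinct_quadruples :: ('v::finite \<times> 'v \<times> 'v \<times> 'v) set)) =
     int CARD('v) * (int CARD('v) - 1) * (int CARD('v) - 2) * (int CARD('v) - 3)"
proof (cases "CARD('v) \<ge> 4")
  case True
  then obtain m where m: "CARD('v) = m + 4" using le_Suc_ex add.commute by metis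
  have "card (distinct_quadruples :: ('v \<times> 'v \<times> 'v \<times> 'v) set) =
      card {xs :: 'v list. length xs = 4 \<and> distinct xs \<and> set xs \<subseteq> UNIV}"
    using bij_betw_same_card[OF bij_betw_distinct_quadruples[of "\<lambda>_. True"]]
    by (simp add: distinct_quadruples_def)
  also have "\<dots> = \<Prod>{CARD('v) - 4 + 1..CARD('v)}"
    using True by (intro card_lists_distinct_length_eq) auto
  also have "{CARD('v) - 4 + 1..CARD('v)} = {m + 1, m + 2, m + 3, m + 4}"
    unfolding m by auto
  finally show ?thesis by (simp add: m algebra_simps)
next
  \<comment> \<open>With one, two or three points there is no such quadruple, and one of the integer
    factors on the right is zero.\<close>
  case False
  have "distinct_quadruples = ({} :: ('v \<times> 'v \<times> 'v \<times> 'v) set)"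
  proof (rule ccontr)
    assume "\<not> ?thesis"
    then obtain w x y z :: 'v where "distinct [w, x, y, z]" by (auto simp: distinct_quadruples_def)
    then have "card {w, x, y, z} = 4" by simp
    then show False using False card_mono[of UNIV "{w, x, y, z}"] by simp
  qed
  moreover have "CARD('v) > 0" by simp
  then have "CARD('v) = 1 \<or> CARD('v) = 2 \<or> CARD('v) = 3" using False by linarith
  ultimately show ?thesis by auto
qed

lemma card_quadruples_four_sets:
  fixes H :: "'v::finite set set"
  assumes "\<And>X. X \<in> H \<Longrightarrow> card X = 4"
  shows "card {(w, x, y, z). distinct [w, x, y, z] \<and> {w, x, y, z} \<in> H} = 24 * card H"
proof -
  have "card {(w, x, y, z). distinct [w, x, y, z] \<and> {w, x, y, z} \<in> H} =
      card {xs. length xs = 4 \<and> distinct xs \<and> set xs \<in> H}"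
    by (rule bij_betw_same_card[OF bij_betw_distinct_quadruples])
  also have "{xs. length xs = 4 \<and> distinct xs \<and> set xs \<in> H} = (\<Union>X\<in>H. permutations_of_set X)"
    using assms distinct_card by (fastforce simp: permutations_of_set_def)
  also have "card \<dots> = (\<Sum>X\<in>H. card (permutations_of_set X))"
    by (rule card_UN_disjoint) (simp, simp, auto simp: permutations_of_set_def)
  also have "\<dots> = 24 * card H"
    using assms by (simp add: fact_numeral)
  finally show ?thesis .
qed

lemma sum_distinct_quadruples:
  fixes h :: "'v::finite \<Rightarrow> 'v \<Rightarrow> 'v \<Rightarrow> 'v \<Rightarrow> int"
  shows "(\<Sum>(w, x, y, z)\<in>distinct_quadruples. h w x y z) =
    (\<Sum>w\<in>UNIV. \<Sum>x\<in>UNIV. \<Sum>y\<in>UNIV. \<Sum>z\<in>UNIV. if distinct [w, x, y, z] then h w x y z else 0)"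
proof -
  have "(\<Sum>(w, x, y, z)\<in>distinct_quadruples. h w x y z) =
      (\<Sum>(w, x, y, z)\<in>UNIV. if distinct [w, x, y, z] then h w x y z else 0)"
    by (rule sum.mono_neutral_cong_left) (auto simp: distinct_quadruples_def)
  then show ?thesis
    by (simp add: sum.cartesian_product UNIV_Times_UNIV)
qed

text \<open>Four points carry three 4-cycles up to rotation and reversal; relabelling shows that all
  three have the same total.\<close>

lemma sum_four_cycle_swap:
  fixes S :: "'v::finite \<Rightarrow> 'v \<Rightarrow> int"
  shows "(\<Sum>(w, x, y, z)\<in>distinct_quadruples. four_cycle S w x z y) =
      (\<Sum>(w, x, y, z)\<in>distinct_quadruples. four_cycle S w x y z)"
    and "(\<Sum>(w, x, y, z)\<in>distinct_quadruples. four_cycle S w y x z) =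
      (\<Sum>(w, x, y, z)\<in>distinct_quadruples. four_cycle S w x y z)"
  by (rule sum.reindex_bij_witness[of _ "\<lambda>(w, x, y, z). (w, x, z, y)" "\<lambda>(w, x, y, z). (w, x, z, y)"];
      auto simp: distinct_quadruples_def)
     (rule sum.reindex_bij_witness[of _ "\<lambda>(w, x, y, z). (w, y, x, z)" "\<lambda>(w, x, y, z). (w, y, x, z)"];
      auto simp: distinct_quadruples_def)

lemma card_four_graph:
  fixes f :: "'a::{ab_group_add, finite} \<Rightarrow> int"
  assumes f: "admissible f"
  defines "n \<equiv> int CARD('a option)"
  shows "96 * int (card (four_graph f)) = n * (n - 1) * (n - 2) * (n - 3)
    - 3 * (\<Sum>(w, x, y, z)\<in>distinct_quadruples. four_cycle (seidel f) w x y z)"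
proof -
  let ?C = "four_cycle (seidel f)"
  let ?Q = "distinct_quadruples :: ('a option \<times> 'a option \<times> 'a option \<times> 'a option) set"
  \<comment> \<open>Each pair lies on two of the three 4-cycles, so the product of the three does
    not depend on the signs and is always -1. Their sum is therefore -3 on an edge and 1 elsewhere.
    The factor 96 below is this 4 times the 4! orderings.\<close>
  have pointwise: "4 * of_bool ({w, x, y, z} \<in> four_graph f) =
      1 - ?C w x y z - ?C w x z y - ?C w y x z" if "distinct [w, x, y, z]" for w x y z
  proof -
    have skew: "seidel f x w = - seidel f w x" "seidel f y w = - seidel f w y"
      "seidel f z w = - seidel f w z" "seidel f y x = - seidel f x y"
      "seidel f z x = - seidel f x z" "seidel f z y = - seidel f y z"
      using seidel_skew[OF f] by blast+
    have "seidel f w x = 1 \<or> seidel f w x = -1" "seidel f w y = 1 \<or> seidel f w y = -1"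
      "seidel f w z = 1 \<or> seidel f w z = -1" "seidel f x y = 1 \<or> seidel f x y = -1"
      "seidel f x z = 1 \<or> seidel f x z = -1" "seidel f y z = 1 \<or> seidel f y z = -1"
      using seidel_sign[OF f] that by auto
    then show ?thesis
      unfolding mem_four_graph_iff[OF f that] unfolding four_cycle_def skew
      by (elim disjE) simp_all
  qed
  have "96 * int (card (four_graph f)) =
      4 * int (card {(w, x, y, z). distinct [w, x, y, z] \<and> {w, x, y, z} \<in> four_graph f})"
    by (subst card_quadruples_four_sets) (auto simp: four_graph_def)
  also have "{(w, x, y, z). distinct [w, x, y, z] \<and> {w, x, y, z} \<in> four_graph f} =
      {(w, x, y, z) \<in> ?Q. {w, x, y, z} \<in> four_graph f}"
    by (auto simp: distinct_quadruples_def)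
  also have "4 * int (card \<dots>) = 4 * (\<Sum>(w, x, y, z)\<in>?Q. of_bool ({w, x, y, z} \<in> four_graph f))"
    by (simp add: sum.inter_filter[symmetric] of_bool_def case_prod_unfold)
  also have "\<dots> = (\<Sum>(w, x, y, z)\<in>?Q. 1 - ?C w x y z - ?C w x z y - ?C w y x z)"
    unfolding sum_distrib_left
    by (rule sum.cong) (use pointwise in \<open>auto simp: distinct_quadruples_def simp del: of_bool_eq_iff\<close>)
  also have "\<dots> = int (card ?Q) - (\<Sum>(w, x, y, z)\<in>?Q. ?C w x y z)
      - (\<Sum>(w, x, y, z)\<in>?Q. ?C w x z y) - (\<Sum>(w, x, y, z)\<in>?Q. ?C w y x z)"
    by (simp add: case_prod_unfold sum_subtractf)
  finally show ?thesis
    by (simp add: sum_four_cycle_swap card_distinct_quadruples n_def)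
qed

text \<open>Expanding the square of an inner product of rows w and y gives closed walks w, x, y, z;
  the two sign changes from skewness cancel. The walks with x = z contribute 1 for each of the n - 2
  vertices other than w and y.\<close>

lemma sum_square_row_products:
  fixes f :: "'a::{ab_group_add, finite} \<Rightarrow> int"
  assumes f: "admissible f"
  defines "n \<equiv> int CARD('a option)"
  shows "(\<Sum>w\<in>UNIV. \<Sum>y\<in>UNIV. if w = y then 0 else
      (\<Sum>x\<in>UNIV. seidel f w x * seidel f y x)\<^sup>2) =
    (\<Sum>(w, x, y, z)\<in>distinct_quadruples. four_cycle (seidel f) w x y z) + n * (n - 1) * (n - 2)"
proof -
  let ?C = "four_cycle (seidel f)"
  have sq: "seidel f a b * seidel f a b = of_bool (a \<noteq> b)" for a b
    using seidel_sign[OF f, of a b] seidel_diag[OF f, of a] by auto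
  have row: "(\<Sum>x\<in>UNIV. seidel f w x * seidel f y x)\<^sup>2 =
      (\<Sum>x\<in>UNIV. \<Sum>z\<in>UNIV. if distinct [w, x, y, z] then ?C w x y z else 0) + (n - 2)"
    if wy: "w \<noteq> y" for w y
  proof -
    have summand: "seidel f w x * seidel f y x * (seidel f w z * seidel f y z) =
        (if distinct [w, x, y, z] then ?C w x y z else 0) +
        (if z = x then of_bool (x \<in> - {w, y}) else 0)" for x z
    proof -
      have "seidel f w x * seidel f y x * (seidel f w z * seidel f y z) = ?C w x y z"
        using seidel_skew[OF f, of x y] seidel_skew[OF f, of z w] by (simp add: four_cycle_def)
      moreover have "?C w x y x = of_bool (x \<in> - {w, y})"
      proof -
        have "?C w x y x = (seidel f w x * seidel f w x) * (seidel f y x * seidel f y x)"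
          using seidel_skew[OF f, of x y] seidel_skew[OF f, of x w] by (simp add: four_cycle_def)
        then show ?thesis by (auto simp: sq)
      qed
      moreover have "?C w x y z = 0" if "x = w \<or> x = y \<or> z = w \<or> z = y"
        using that seidel_diag[OF f] by (auto simp: four_cycle_def)
      ultimately show ?thesis using wy by auto
    qed
    have "(\<Sum>x\<in>UNIV. seidel f w x * seidel f y x)\<^sup>2 =
        (\<Sum>x\<in>UNIV. \<Sum>z\<in>UNIV. seidel f w x * seidel f y x * (seidel f w z * seidel f y z))"
      by (simp only: power2_eq_square sum_product)
    also have "\<dots> = (\<Sum>x\<in>UNIV. \<Sum>z\<in>UNIV. if distinct [w, x, y, z] then ?C w x y z else 0) +
        (\<Sum>x\<in>UNIV. of_bool (x \<in> - {w, y}))"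
      unfolding summand sum.distrib by (simp only: sum.delta' finite UNIV_I if_True sum.delta)
    also have "(\<Sum>x\<in>UNIV. of_bool (x \<in> - {w, y})) = (\<Sum>x\<in>- {w, y}. 1)"
      by (rule sum.mono_neutral_cong_right) auto
    also have "\<dots> = int (card (- {w, y}))"
      by simp
    also have "int (card (- {w, y})) = n - 2"
      using wy card_mono[of UNIV "{w, y}"]
      by (simp add: Compl_eq_Diff_UNIV card_Diff_subset n_def of_nat_diff)
    finally show ?thesis .
  qed
  \<comment> \<open>For w = y no quadruple is distinct, so the constant n - 2 has to be taken off
    again there; it survives for n (n - 1) ordered pairs.\<close>
  have "(\<Sum>w\<in>UNIV. \<Sum>y\<in>UNIV. if w = y then 0 else
      (\<Sum>x\<in>UNIV. seidel f w x * seidel f y x)\<^sup>2) =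
    (\<Sum>w\<in>UNIV. \<Sum>y\<in>UNIV.
      (\<Sum>x\<in>UNIV. \<Sum>z\<in>UNIV. if distinct [w, x, y, z] then ?C w x y z else 0) +
      (n - 2 - (if y = w then n - 2 else 0)))"
    by (intro sum.cong refl) (auto simp: row)
  also have "\<dots> = (\<Sum>w\<in>UNIV. \<Sum>y\<in>UNIV. \<Sum>x\<in>UNIV. \<Sum>z\<in>UNIV.
      if distinct [w, x, y, z] then ?C w x y z else 0) + n * (n - 1) * (n - 2)"
    by (simp only: sum.distrib sum_subtractf sum.delta' sum.delta finite UNIV_I if_True sum_constant n_def)
       (simp add: algebra_simps)
  also have "(\<Sum>w\<in>UNIV. \<Sum>y\<in>UNIV. \<Sum>x\<in>UNIV. \<Sum>z\<in>UNIV.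
      if distinct [w, x, y, z] then ?C w x y z else 0) =
    (\<Sum>(w, x, y, z)\<in>distinct_quadruples. ?C w x y z)"
    unfolding sum_distinct_quadruples by (intro sum.cong refl sum.swap)
  finally show ?thesis .
qed

text \<open>The sum of squares above is nonnegative, which bounds the number of edges from above;
  the assumed count attains this bound, so distinct rows are orthogonal.\<close>

lemma extremal_autocorrelation:
  fixes f :: "'a::{ab_group_add, finite} \<Rightarrow> int"
  assumes f: "admissible f"
    and n: "n = CARD('a option)"
    and extremal: "real (card (four_graph f)) = real n / 16 * real (n choose 3)"
    and "d \<noteq> 0"
  shows "(\<Sum>a\<in>UNIV. f a * f (d - a)) = 1"
proof -
  define N where "N = int n"
  define D where "D = (\<Sum>(w, x, y, z)\<in>distinct_quadruples. four_cycle (seidel f) w x y z)"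
  have "real n * (real n - 1) * (real n - 2) = 6 * real (n choose 3)"
    by (simp add: binomial_gbinomial gbinomial_prod_rev numeral_eq_Suc fact_numeral)
  then have "96 * real (card (four_graph f)) = real n * (real n * (real n - 1) * (real n - 2))"
    using extremal by simp
  then have "real_of_int (96 * int (card (four_graph f))) = real_of_int (N * (N * (N - 1) * (N - 2)))"
    by (simp add: N_def)
  then have "96 * int (card (four_graph f)) = N * (N * (N - 1) * (N - 2))"
    by (simp only: of_int_eq_iff)
  \<comment> \<open>Both expressions for 96 times the edge count contain N (N - 1) (N - 2), with
    cofactors N and N - 3; their difference yields the 3.\<close>
  then have "3 * (D + N * (N - 1) * (N - 2)) = 0"
    using card_four_graph[OF f] by (simp add: D_def N_def n algebra_simps)
  then have zero: "(\<Sum>w\<in>UNIV. \<Sum>y\<in>UNIV. if w = y then 0 else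
      (\<Sum>x\<in>UNIV. seidel f w x * seidel f y x)\<^sup>2) = 0"
    using sum_square_row_products[OF f] by (simp add: D_def N_def n)
  have "(\<Sum>y\<in>UNIV. if w = y then 0 else (\<Sum>x\<in>UNIV. seidel f w x * seidel f y x)\<^sup>2) = 0" for w
    using zero by (subst (asm) sum_nonneg_eq_0_iff) (auto intro!: sum_nonneg)
  then have "(if w = y then 0 else (\<Sum>x\<in>UNIV. seidel f w x * seidel f y x)\<^sup>2) = 0" for w y
    by (subst (asm) sum_nonneg_eq_0_iff) auto
  \<comment> \<open>In the product of these two rows the column of infinity contributes the summand
    1; oddness of f turns the remaining correlation into a convolution.\<close>
  from this[of "Some 0" "Some d"] have "(\<Sum>x\<in>UNIV. seidel f (Some 0) x * seidel f (Some d) x) = 0"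
    using \<open>d \<noteq> 0\<close> by simp
  then have "1 + (\<Sum>a\<in>UNIV. f a * f (a - d)) = 0"
    by (simp add: UNIV_option_conv sum.reindex)
  moreover have "f a * f (d - a) = - (f a * f (a - d))" for a
    using admissible_odd[OF f, of "a - d"] by simp
  ultimately show ?thesis by (simp add: sum_negf)
qed

section \<open>Multipliers in the group ring\<close>

lemma prime_power_add_cong:
  fixes x y :: "'r::comm_ring_1"
  assumes "prime q"
  shows "of_nat q dvd (x + y) ^ q - (x ^ q + y ^ q)"
proof -
  have q: "q > 0" using assms by (simp add: prime_gt_0_nat)
  have "(x + y) ^ q = (\<Sum>k\<le>q. of_nat (q choose k) * x ^ k * y ^ (q - k))"
    by (rule binomial_ring)
  also have "{..q} = insert 0 (insert q {1..<q})" using q by auto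
  also have "(\<Sum>k\<in>\<dots>. of_nat (q choose k) * x ^ k * y ^ (q - k)) =
      y ^ q + (x ^ q + (\<Sum>k\<in>{1..<q}. of_nat (q choose k) * x ^ k * y ^ (q - k)))"
    using q by simp
  finally have "(x + y) ^ q - (x ^ q + y ^ q) =
      (\<Sum>k\<in>{1..<q}. of_nat (q choose k) * x ^ k * y ^ (q - k))" by simp
  also have "of_nat q dvd \<dots>"
  proof (rule dvd_sum)
    fix k assume "k \<in> {1..<q}"
    then have "q dvd (q choose k)" by (intro dvd_choose_prime) (use assms in auto)
    then have "(of_nat q :: 'r) dvd of_nat (q choose k)" by (auto simp: dvd_def)
    then show "(of_nat q :: 'r) dvd of_nat (q choose k) * x ^ k * y ^ (q - k)"
      by simp
  qed
  finally show ?thesis .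
qed

lemma prime_power_sum_cong:
  fixes g :: "'b \<Rightarrow> 'r::comm_ring_1"
  assumes "prime q"
  shows "of_nat q dvd (\<Sum>i\<in>I. g i) ^ q - (\<Sum>i\<in>I. g i ^ q)"
proof (induction I rule: infinite_finite_induct)
  case (insert i I)
  have "of_nat q dvd ((g i + sum g I) ^ q - (g i ^ q + sum g I ^ q)) +
    (sum g I ^ q - (\<Sum>i\<in>I. g i ^ q))"
    using prime_power_add_cong[OF assms] insert.IH by (rule dvd_add)
  then show ?case using insert.hyps by (simp add: algebra_simps)
qed (use prime_gt_0_nat[OF assms] in \<open>auto simp: power_0_left\<close>)

section \<open>The integral group ring, as \<open>Poly_Mapping\<close> with the convolution
  product\<close>

lemma single_power:
  fixes a :: "'a::comm_semiring_1" and c :: "'b::comm_semiring_1"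
  shows "Poly_Mapping.single a c ^ k = Poly_Mapping.single (of_nat k * a) (c ^ k)"
  by (induction k) (simp_all add: mult_single algebra_simps)

lemma poly_mapping_eq_sum_single:
  fixes P :: "'a::finite \<Rightarrow>\<^sub>0 'b::comm_monoid_add"
  shows "P = (\<Sum>a\<in>UNIV. Poly_Mapping.single a (Poly_Mapping.lookup P a))"
  by (rule poly_mapping_eqI) (simp add: lookup_sum lookup_single when_def)

lemma lookup_times_finite:
  fixes P Q :: "'a::{ab_group_add, finite} \<Rightarrow>\<^sub>0 'b::comm_semiring_1"
  shows "Poly_Mapping.lookup (P * Q) d = (\<Sum>a\<in>UNIV. Poly_Mapping.lookup P a * Poly_Mapping.lookup Q (d - a))"
proof -
  have "P * Q = (\<Sum>a\<in>UNIV. Poly_Mapping.single a (Poly_Mapping.lookup P a)) *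
      (\<Sum>b\<in>UNIV. Poly_Mapping.single b (Poly_Mapping.lookup Q b))"
    using poly_mapping_eq_sum_single[of P] poly_mapping_eq_sum_single[of Q] by simp
  also have "Poly_Mapping.lookup \<dots> d =
      (\<Sum>a\<in>UNIV. \<Sum>b\<in>UNIV. if b = d - a then Poly_Mapping.lookup P a * Poly_Mapping.lookup Q b else 0)"
    by (simp add: sum_product mult_single lookup_sum lookup_single when_def eq_diff_eq add.commute)
  also have "\<dots> = (\<Sum>a\<in>UNIV. Poly_Mapping.lookup P a * Poly_Mapping.lookup Q (d - a))"
    by simp
  finally show ?thesis .
qed

lemma lookup_of_int_times:
  fixes P :: "'a::{ab_group_add, finite} \<Rightarrow>\<^sub>0 int"
  shows "Poly_Mapping.lookup (of_int c * P) d = c * Poly_Mapping.lookup P d"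
  by (simp add: lookup_times_finite lookup_of_int when_def if_distrib[of "\<lambda>x. x * _"] cong: if_cong)

text \<open>Oddness of q enters three times: the q-th power of F is a multiple of F, the values of f
  equal their q-th powers, and q exceeds 2.\<close>

lemma multiplier_odd_prime:
  fixes f :: "'a::{field, finite} \<Rightarrow> int"
  assumes f: "admissible f"
    and conv: "\<And>d. d \<noteq> 0 \<Longrightarrow> (\<Sum>a\<in>UNIV. f a * f (d - a)) = 1"
    and q: "prime q" "odd q"
  shows "f (of_nat q * a) = f 1 * f (of_nat q) * f a"
proof (cases "of_nat q = (0::'a)")
  case True
  then show ?thesis using f by (simp add: admissible_zero_iff)
next
  case q0: False
  define F where "F = Abs_poly_mapping f"
  have F: "Poly_Mapping.lookup F = f" by (simp add: F_def)
  define N where "N = int CARD('a)"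
  \<comment> \<open>This is F^2 = J - N, with J the sum of all group elements; at 0 oddness gives
    minus the number of nonzero elements.\<close>
  have FF: "Poly_Mapping.lookup (F * F) d = (if d = 0 then 1 - N else 1)" for d
  proof (cases "d = 0")
    case True
    have "Poly_Mapping.lookup (F * F) d = (\<Sum>a\<in>UNIV. - (f a * f a))"
      by (simp add: lookup_times_finite F True admissible_odd[OF f])
    also have "\<dots> = - (\<Sum>a\<in>UNIV. if a \<in> - {0::'a} then 1 else 0)"
      by (subst sum_negf[symmetric]) (auto intro!: sum.cong simp: admissible_square[OF f])
    also have "\<dots> = - int (card (- {0::'a}))"
      by (subst sum.inter_restrict[symmetric]) auto
    also have "card (- {0::'a}) = CARD('a) - 1"
      by (simp add: Compl_eq_Diff_UNIV card_Diff_singleton)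
    finally show ?thesis using True by (simp add: N_def of_nat_diff Suc_leI)
  qed (simp add: lookup_times_finite F conv)
  \<comment> \<open>F J vanishes because the values of f sum to zero.\<close>
  have FFF: "F * F * F = of_int (- N) * F"
  proof (rule poly_mapping_eqI)
    fix d
    have "Poly_Mapping.lookup (F * (F * F)) d = (\<Sum>a\<in>UNIV. f a - (if a = d then N * f a else 0))"
      by (simp only: lookup_times_finite[of F "F * F"] FF F) (rule sum.cong, auto simp: algebra_simps)
    also have "\<dots> = - N * f d"
      by (simp add: sum_subtractf admissible_sum[OF f])
    finally show "Poly_Mapping.lookup (F * F * F) d = Poly_Mapping.lookup (of_int (- N) * F) d"
      by (simp only: lookup_of_int_times F mult.assoc)
  qed
  have pow: "F ^ (2 * k + 1) = of_int ((- N) ^ k) * F" for k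
  proof (induction k)
    case (Suc k)
    have "F ^ (2 * Suc k + 1) = F ^ (2 * k + 1) * (F * F)"
      by (simp add: algebra_simps)
    also have "\<dots> = of_int ((- N) ^ k) * (F * F * F)"
      by (simp only: Suc.IH mult.assoc)
    also have "\<dots> = of_int ((- N) ^ Suc k) * F"
      unfolding FFF by (simp add: algebra_simps)
    finally show ?case .
  qed simp
  obtain k where k: "q = 2 * k + 1" using q(2) by (rule oddE)
  define c where "c = (- N) ^ k"
  have fq: "f b ^ q = f b" for b
    by (rule admissible_cases[OF f, of b]) (use q in \<open>simp_all add: k\<close>)
  have "(\<Sum>b\<in>UNIV. Poly_Mapping.single b (f b)) ^ q = of_int c * F"
    using pow[of k] poly_mapping_eq_sum_single[of F] by (simp only: F c_def k)
  moreover have "(\<Sum>b\<in>UNIV. Poly_Mapping.single b (f b) ^ q) =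
      (\<Sum>b\<in>UNIV. Poly_Mapping.single (of_nat q * b) (f b))"
    by (simp add: single_power fq)
  ultimately have "of_nat q dvd of_int c * F - (\<Sum>b\<in>UNIV. Poly_Mapping.single (of_nat q * b) (f b))"
    using prime_power_sum_cong[OF q(1), of "\<lambda>b. Poly_Mapping.single b (f b)" UNIV] by simp
  then obtain R where
    R: "of_int c * F - (\<Sum>b\<in>UNIV. Poly_Mapping.single (of_nat q * b) (f b)) = of_int (int q) * R"
    by (auto simp: dvd_def)
  \<comment> \<open>Compare coefficients at q b; multiplication by q is injective because q is
    nonzero in the field.\<close>
  have cong: "[f b = c * f (of_nat q * b)] (mod int q)" for b
  proof -
    have "Poly_Mapping.lookup (\<Sum>b'\<in>UNIV. Poly_Mapping.single (of_nat q * b') (f b')) (of_nat q * b) = f b"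
      using q0 by (simp add: lookup_sum lookup_single when_def)
    then have "c * f (of_nat q * b) - f b = int q * Poly_Mapping.lookup R (of_nat q * b)"
      using arg_cong[OF R, of "\<lambda>P. Poly_Mapping.lookup P (of_nat q * b)"]
      by (simp only: lookup_minus lookup_of_int_times F)
    then show ?thesis by (metis cong_iff_dvd_diff cong_sym dvd_triv_left)
  qed
  have "[f (of_nat q * a) = f 1 * f (of_nat q) * f a] (mod int q)"
  proof -
    define u where "u = f (of_nat q)"
    have u: "u * u = 1" using admissible_square[OF f, of "of_nat q"] q0 by (simp add: u_def)
    \<comment> \<open>Taking b = 1 expresses the unknown c through values of f; being a product of
      two signs, it squares to 1 modulo q.\<close>
    have "[f 1 * u = c] (mod int q)"
      using cong_scalar_right[OF cong[of 1], of u] u by (simp add: mult.assoc u_def)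
    then have "[f 1 * u * f a = c * (c * f (of_nat q * a))] (mod int q)"
      using cong[of a] by (rule cong_mult)
    moreover have "[c * c = 1] (mod int q)"
    proof -
      have "[(f 1 * u) * (f 1 * u) = c * c] (mod int q)"
        using \<open>[f 1 * u = c] (mod int q)\<close> by (intro cong_mult)
      moreover have "(f 1 * u) * (f 1 * u) = (f 1 * f 1) * (u * u)" by simp
      then have "(f 1 * u) * (f 1 * u) = 1"
        using u admissible_square[OF f, of 1] by simp
      ultimately show ?thesis by (simp add: cong_sym_eq)
    qed
    then have "[c * c * f (of_nat q * a) = 1 * f (of_nat q * a)] (mod int q)"
      by (rule cong_scalar_right)
    ultimately show ?thesis
      by (metis cong_sym cong_trans mult.assoc mult_1 u_def)
  qed
  then have dvd: "int q dvd f (of_nat q * a) - f 1 * f (of_nat q) * f a"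
    by (simp add: cong_iff_dvd_diff)
  \<comment> \<open>Both sides lie between -1 and 1, so they differ by at most 2, which is less than
    q.\<close>
  have bound: "\<bar>f b\<bar> \<le> 1" for b
    by (rule admissible_cases[OF f, of b]) auto
  have "\<bar>f 1 * f (of_nat q) * f a\<bar> \<le> 1 * 1 * 1"
    unfolding abs_mult by (intro mult_mono bound) auto
  then have "\<bar>f (of_nat q * a) - f 1 * f (of_nat q) * f a\<bar> < int q"
    using bound[of "of_nat q * a"] q prime_ge_2_nat[of q] by (cases "q = 2") auto
  then show ?thesis
    using dvd dvd_imp_le_int[of "f (of_nat q * a) - f 1 * f (of_nat q) * f a" "int q"] by auto
qed

text \<open>Induction on the prime factorisation: every prime factor of an odd number is odd, and
  multipliers compose.\<close>

lemma multiplier_odd: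
  fixes f :: "'a::{field, finite} \<Rightarrow> int"
  assumes f: "admissible f"
    and conv: "\<And>d. d \<noteq> 0 \<Longrightarrow> (\<Sum>a\<in>UNIV. f a * f (d - a)) = 1"
    and "odd m"
  shows "f (of_nat m * a) = f 1 * f (of_nat m) * f a"
proof -
  have "m \<noteq> 0" using \<open>odd m\<close> by (rule odd_pos[THEN less_imp_neq, symmetric])
  then show ?thesis using \<open>odd m\<close>
  proof (induction m arbitrary: a rule: prime_divisors_induct)
    case zero
    then show ?case by simp
  next
    case (unit m)
    then show ?case using admissible_square[OF f, of 1] by simp
  next
    case (factor q m)
    have m: "f (of_nat m * b) = f 1 * f (of_nat m) * f b" for b
      using factor by auto
    have q: "f (of_nat q * b) = f 1 * f (of_nat q) * f b" for b
      using multiplier_odd_prime[OF f conv] factor by auto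
    show ?case
      by (simp add: mult.assoc q m)
  qed
qed

section \<open>From multipliers to the quadratic character\<close>

lemma finite_field_prime_card:
  assumes "CARD('a::{field, finite}) = p" "prime p"
  shows "CHAR('a) = p" and "surj (of_nat :: nat \<Rightarrow> 'a)"
proof -
  have "CHAR('a) dvd p" using CHAR_dvd_CARD[where 'a = 'a] assms(1) by simp
  then show C: "CHAR('a) = p"
    using assms(2) CHAR_not_1' by (metis prime_nat_iff One_nat_def)
  have "inj_on (of_nat :: nat \<Rightarrow> 'a) {..<p}"
    by (auto simp: inj_on_def of_nat_eq_iff_cong_CHAR C cong_def)
  then have "card ((of_nat :: nat \<Rightarrow> 'a) ` {..<p}) = CARD('a)"
    by (simp add: card_image assms(1))
  then have "(of_nat :: nat \<Rightarrow> 'a) ` {..<p} = UNIV"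
    by (intro card_subset_eq) auto
  then show "surj (of_nat :: nat \<Rightarrow> 'a)" by blast
qed

text \<open>Multiplicativity makes f constant on nonzero squares, and oddness gives the opposite
  value on their negatives. Counting shows that these two sets exhaust the nonzero elements.\<close>

lemma perfect_admissible_eq_quad_char:
  fixes f :: "'a::{field, finite} \<Rightarrow> int"
  assumes f: "admissible f"
    and conv: "\<And>d. d \<noteq> 0 \<Longrightarrow> (\<Sum>a\<in>UNIV. f a * f (d - a)) = 1"
    and p: "prime p" "CARD('a) = p"
  shows "f a = f 1 * quad_char a"
proof -
  define g where "g b = f 1 * f b" for b
  have ff: "f 1 * f 1 = 1" using admissible_square[OF f, of 1] by simp
  note C = finite_field_prime_card[OF p(2,1)]
  have neg1: "f (- 1) = - f 1" by (rule admissible_odd[OF f])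
  \<comment> \<open>In characteristic 2 oddness would force \<open>f 1 = - f 1\<close>.\<close>
  have "p \<noteq> 2"
  proof
    assume "p = 2"
    then have "(of_nat 2 :: 'a) = 0" using C(1) of_nat_CHAR by metis
    then have "(- 1 :: 'a) = 1" by (simp add: eq_neg_iff_add_eq_0 neg_eq_iff_add_eq_0)
    then have "f 1 = - f 1" using neg1 by metis
    then show False using ff by simp
  qed
  then have "odd p" using p(1) prime_odd_nat prime_ge_2_nat[of p] by fastforce
  have mult: "f (b * a) = f 1 * f b * f a" for a b
  proof -
    obtain m where m: "b = of_nat m" using C(2) by (metis surjD)
    \<comment> \<open>Adding the odd characteristic p makes an even representative odd without
      changing the field element.\<close>
    define m' where "m' = (if odd m then m else m + p)"
    have "odd m'" using \<open>odd p\<close> by (simp add: m'_def)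
    have m': "b = of_nat m'" using C(1) of_nat_CHAR[where 'a = 'a] by (simp add: m'_def m)
    show ?thesis
      unfolding m' using multiplier_odd[OF f conv \<open>odd m'\<close>] by blast
  qed
  have sq: "f (y\<^sup>2) = f 1" if "y \<noteq> 0" for y
    using mult[of y y] admissible_square[OF f, of y] that by (simp add: power2_eq_square)
  have f1: "f 1 \<noteq> 0" using f by (simp add: admissible_zero_iff)
  define S where "S = (\<lambda>y::'a. y\<^sup>2) ` (- {0})"
  have S: "f s = f 1" "s \<noteq> 0" if "s \<in> S" for s
    using that sq by (auto simp: S_def)
  have disj: "S \<inter> uminus ` S = {}"
  proof -
    have "f (- s) \<noteq> f t" if "s \<in> S" "t \<in> S" for s t
      using S(1)[OF that(1)] S(1)[OF that(2)] f1 by (simp add: admissible_odd[OF f])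
    then show ?thesis by auto
  qed
  \<comment> \<open>Squaring is at most two-to-one, so S has at least half as many elements as there
    are nonzero ones; S and its negative are disjoint and hence fill everything.\<close>
  have "card (- {0::'a}) \<le> (\<Sum>s\<in>S. card {y \<in> - {0}. y\<^sup>2 = s})"
    by (subst card_UN_disjoint[symmetric])
       (auto intro!: card_mono simp: S_def)
  also have "\<dots> \<le> (\<Sum>s\<in>S. 2)"
  proof (rule sum_mono)
    fix s assume "s \<in> S"
    then obtain y where "s = y\<^sup>2" by (auto simp: S_def)
    then have "{z \<in> - {0}. z\<^sup>2 = s} \<subseteq> {y, - y}" by (auto simp: power2_eq_iff)
    then have "card {z \<in> - {0}. z\<^sup>2 = s} \<le> card {y, - y}" by (intro card_mono) auto
    also have "\<dots> \<le> 2" by (simp add: card_insert_if)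
    finally show "card {z \<in> - {0}. z\<^sup>2 = s} \<le> 2" .
  qed
  also have "\<dots> = card S + card (uminus ` S)"
    by (simp add: card_image)
  also have "\<dots> = card (S \<union> uminus ` S)"
    using disj by (simp add: card_Un_disjoint)
  finally have cover: "S \<union> uminus ` S = - {0}"
    using S by (intro card_seteq) auto
  show ?thesis
  proof (cases "a = 0")
    case True
    then show ?thesis using f by (simp add: quad_char_def admissible_zero_iff)
  next
    case a0: False
    show ?thesis
    proof (cases "a \<in> S")
      case True
      then have "quad_char a = 1" using a0 by (auto simp: quad_char_def S_def)
      then show ?thesis using S(1)[OF True] by simp
    next
      case False
      \<comment> \<open>Outside S, a nonzero a is a nonsquare, and by the covering it is the
        negative of a square.\<close>
      then have "\<nexists>y. a = y\<^sup>2" using a0 unfolding S_def by force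
      then have "quad_char a = -1" using a0 unfolding quad_char_def by presburger
      moreover have "a \<in> S \<union> uminus ` S" using a0 unfolding cover by simp
      then obtain s where "s \<in> S" "a = - s" using False by blast
      then have "f (- a) = f 1" using S(1) by simp
      ultimately show ?thesis by (simp add: admissible_odd[OF f])
    qed
  qed
qed

theorem theorem5p1:
  fixes p n :: nat and f :: "'a::{field, finite} \<Rightarrow> int"
  assumes "prime p" and "[p = 3] (mod 4)" and "CARD('a) = p"
    and "admissible f"
    and "n = p + 1"
    and "\<not> contains_H4 (four_graph f)"
    and "real (card (four_graph f)) = real n / 16 * real (n choose 3)"
  shows "four_graph f = four_graph (quad_char :: 'a \<Rightarrow> int)"
proof -
  note f = \<open>admissible f\<close>
  have n: "n = CARD('a option)" using assms(3,5) by simp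
  have eq: "f a = f 1 * quad_char a" for a
    by (rule perfect_admissible_eq_quad_char[OF f extremal_autocorrelation[OF f n assms(7)] assms(1,3)])
  \<comment> \<open>Only the sign of \<open>f 1\<close> remains open; the value 0 would mean 1 = 0
    in the field.\<close>
  from f show ?thesis
  proof (cases rule: admissible_cases[of f 1])
    case 2
    then have "f a = quad_char a" for a using eq[of a] by simp
    then have "f = quad_char" by (rule ext)
    then show ?thesis by simp
  next
    case 3
    then have "quad_char a = - f a" for a using eq[of a] by simp
    then have "quad_char = (\<lambda>a. - f a)" by (rule ext)
    then show ?thesis using four_graph_uminus[OF f] by simp
  qed simp
qed

end
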